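(* There is no $2$-connected nontrivial uniquely $C_9$-saturated graph $G$ whose longest even cycle of length at most $12$ has length $12$; that is, no $2$-connected nontrivial uniquely $C_9$-saturated graph contains a cycle of length $12$.
   Context: All graphs are finite and simple. A graph $G$ is uniquely $C_9$-saturated if it contains no cycle of length $9$ and, for every edge $e$ of the complement $\overline{G}$, $G+e$ contains exactly one cycle of length $9$; it is nontrivial if $|V(G)|\ge 9$. "Longest even cycle of length at most $12$" means a longest cycle among all even cycles of $G$ whose length is at most $12$. *)

theory Defs
  imports "Graph_Theory.Graph_Theory"
begin

text \<open>
  A finite simple graph is a \<^locale>\<open>pair_graph\<close>: a finite, loopfree, symmetric digraph
  without parallel arcs. The edge \<open>uv\<close> is the pair of arcs \<open>(u, v)\<close> and \<open>(v, u)\<close>.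
\<close>

definition arc_edge :: "'a \<times> 'a \<Rightarrow> 'a set" where
  "arc_edge a = {fst a, snd a}"

text \<open>
  A cycle of an undirected graph is a subgraph, represented by its edge set \<open>C\<close>; its length is
  \<open>card C\<close>. In contrast, \<^const>\<open>pre_digraph.cycle\<close> describes closed arc walks: each undirected
  cycle of length \<open>n\<close> arises from \<open>2 * n\<close> of them (choice of starting point and direction), and
  the walks \<open>u, v, u\<close> along a single edge have to be excluded by the bound on the length.
\<close>

definition ucycle :: "'a pair_pre_digraph \<Rightarrow> 'a set set \<Rightarrow> bool" where
  "ucycle G C \<longleftrightarrow>
     (\<exists>p. pre_digraph.cycle (with_proj G) p \<and> 3 \<le> length p \<and> C = arc_edge ` set p)"

definition add_edge :: "'a pair_pre_digraph \<Rightarrow> 'a \<Rightarrow> 'a \<Rightarrow> 'a pair_pre_digraph" where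
  "add_edge G u v = G\<lparr>parcs := parcs G \<union> {(u, v), (v, u)}\<rparr>"

definition uniquely_cycle_saturated :: "nat \<Rightarrow> 'a pair_pre_digraph \<Rightarrow> bool" where
  "uniquely_cycle_saturated n G \<longleftrightarrow>
     \<not> (\<exists>C. ucycle G C \<and> card C = n) \<and>
     (\<forall>u\<in>pverts G. \<forall>v\<in>pverts G. u \<noteq> v \<longrightarrow> (u, v) \<notin> parcs G \<longrightarrow>
        (\<exists>!C. ucycle (add_edge G u v) C \<and> card C = n))"

definition k_connected :: "nat \<Rightarrow> 'a pair_pre_digraph \<Rightarrow> bool" where
  "k_connected k G \<longleftrightarrow>
     k < card (pverts G) \<and>
     (\<forall>X. X \<subseteq> pverts G \<longrightarrow> card X < k \<longrightarrow> connected (with_proj G \<restriction> (pverts G - X)))"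

definition longest_even_cycle_upto :: "nat \<Rightarrow> 'a pair_pre_digraph \<Rightarrow> 'a set set \<Rightarrow> bool" where
  "longest_even_cycle_upto m G C \<longleftrightarrow>
     is_arg_max card (\<lambda>D. ucycle G D \<and> even (card D) \<and> card D \<le> m) C"

end

theory Submission
  imports Defs
begin

text \<open>
  Call a path on nine vertices a nine-path. For vertices \<open>u \<noteq> v\<close> the 9-cycles of \<open>G + uv\<close> through
  \<open>uv\<close> correspond to the nine-paths from \<open>u\<close> to \<open>v\<close>. So unique \<open>C\<^sub>9\<close>-saturation says: adjacent
  vertices are joined by no nine-path, and distinct nonadjacent ones by exactly one. In particular
  no two nine-paths share both ends, whether or not the ends are adjacent.

  Let \<open>c\<^sub>0, \<dots>, c\<^sub>1\<^sub>1\<close> be a 12-cycle. Uniqueness leaves hardly any room for further vertices and edges: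

  \<^item> A chord spans 2 (a short chord) or 6 (a diagonal); every other span yields a 9-cycle or two
    nine-paths with the same ends (\<open>chord_cases\<close>).
  \<^item> A path of length two that leaves the cycle can be prolonged around the cycle in both directions
    up to the antipode, which gives two nine-paths with the same ends (\<open>no_pendant_two_path\<close>). Hence
    vertices outside the cycle have neighbours on the cycle only. By 2-connectedness they have at
    least two neighbours, and these turn out to be two consecutive cycle vertices: each outside
    vertex is an ear (\<open>outside_is_ear\<close>).
  \<^item> Short chords, diagonals and ears exclude each other. On an arc of the cycle, a short chord saves
    one edge and an ear costs one more edge, so that two such devices turn an arc of length 9, 8 or 7
    into two paths of length 8. A diagonal gives a path of length 8 whose ends are also joined by an
    arc of length 9, and another one whose ends are joined by an arc of length 7. Two diagonals
    give two paths of length 8 with the same ends.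

  So \<open>G\<close> is a 12-cycle together with at most one short chord, diagonal or ear. In each of these
  graphs there are nonadjacent cycle vertices, at distance 3 or 5, that no nine-path joins, which
  contradicts saturation (\<open>no_twelve_cycle\<close>).
\<close>

section \<open>Paths and their enumeration\<close>

definition gpath :: "('a \<Rightarrow> 'a \<Rightarrow> bool) \<Rightarrow> 'a list \<Rightarrow> bool" where
  "gpath E xs \<longleftrightarrow> distinct xs \<and> successively E xs"

text \<open>
  The last vertices of the paths with \<open>n\<close> further edges that prolong a path already traversed. That
  path is given in reverse, so that its head is the current vertex; \<open>N\<close> lists the neighbours.
\<close>

fun path_ends :: "(nat \<Rightarrow> nat list) \<Rightarrow> nat \<Rightarrow> nat list \<Rightarrow> nat list" where
  "path_ends N n [] = []"
| "path_ends N 0 (k # ks) = [k]"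
| "path_ends N (Suc n) (k # ks) =
     concat (map (\<lambda>l. path_ends N n (l # k # ks)) (filter (\<lambda>l. l \<notin> set (k # ks)) (N k)))"

text \<open>
  Neighbour lists of the 12-cycle on \<open>{..<12}\<close>, with the chord from \<open>0\<close> to \<open>d\<close> or with an additional
  vertex \<open>12\<close> adjacent to \<open>0\<close> and \<open>1\<close>.
\<close>

definition cycle_plus_edge :: "nat \<Rightarrow> nat \<Rightarrow> nat list" where
  "cycle_plus_edge d k = [(k + 1) mod 12, (k + 11) mod 12] @
      (if k = 0 then [d] else []) @ (if k = d then [0] else [])"

definition cycle_plus_ear :: "nat \<Rightarrow> nat list" where
  "cycle_plus_ear k = (if k = 12 then [0, 1] else
      [(k + 1) mod 12, (k + 11) mod 12] @ (if k = 0 \<or> k = 1 then [12] else []))"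

text \<open>
  The pairs lie on a stretch of vertices of degree 2, so that a path between them either runs along
  the stretch or around the rest of the graph; neither is possible in length 8.
\<close>

lemma nine_paths_miss_vertex:
  "9 \<notin> set (path_ends (cycle_plus_edge 2) 8 [4])"
  "4 \<notin> set (path_ends (cycle_plus_edge 6) 8 [1])"
  "6 \<notin> set (path_ends cycle_plus_ear 8 [3])"
proof -
  show "9 \<notin> set (path_ends (cycle_plus_edge 2) 8 [4])" by code_simp
  show "4 \<notin> set (path_ends (cycle_plus_edge 6) 8 [1])" by code_simp
  show "6 \<notin> set (path_ends cycle_plus_ear 8 [3])" by code_simp
qed

section \<open>Graphs with unique nine-paths\<close>

text \<open>
  Unique \<open>C\<^sub>9\<close>-saturation in terms of paths. The assumption \<open>nine_path_unique\<close> covers adjacent ends as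
  well, where it holds vacuously. 2-connectedness enters through \<open>other_neighbour\<close>.
\<close>

locale unique_nine_path_graph =
  fixes V :: "'a set" and E :: "'a \<Rightarrow> 'a \<Rightarrow> bool"
  assumes sym: "E x y \<Longrightarrow> E y x"
    and irrefl: "\<not> E x x"
    and in_V: "E x y \<Longrightarrow> x \<in> V"
    and other_neighbour: "E x y \<Longrightarrow> \<exists>z. z \<noteq> y \<and> E x z"
    and no_nine_cycle: "gpath E xs \<Longrightarrow> length xs = 9 \<Longrightarrow> \<not> E (hd xs) (last xs)"
    and nine_path_exists: "\<lbrakk>x \<in> V; y \<in> V; x \<noteq> y; \<not> E x y\<rbrakk>
          \<Longrightarrow> \<exists>xs. gpath E xs \<and> length xs = 9 \<and> hd xs = x \<and> last xs = y"
    and nine_path_unique: "\<lbrakk>gpath E xs; gpath E ys; length xs = 9; length ys = 9;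
           hd xs = hd ys; last xs = last ys\<rbrakk> \<Longrightarrow> xs = ys"
begin

text \<open>
  A 12-cycle is a 12-periodic sequence of vertices, so that a change of the starting point is a shift
  of the argument.
\<close>

definition twelve_cycle :: "(nat \<Rightarrow> 'a) \<Rightarrow> bool" where
  "twelve_cycle c \<longleftrightarrow> (\<forall>i. E (c i) (c (i + 1))) \<and> (\<forall>i j. c i = c j \<longleftrightarrow> i mod 12 = j mod 12)"

lemma twelve_cycle_shift: "twelve_cycle c \<Longrightarrow> twelve_cycle (\<lambda>i. c (r + i))"
  unfolding twelve_cycle_def
  by (auto simp: add.assoc[symmetric] nat_mod_eq_iff mod_add_left_eq)

lemma twelve_cycle_eq_iff: "twelve_cycle c \<Longrightarrow> c i = c j \<longleftrightarrow> i mod 12 = j mod 12"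
  by (simp add: twelve_cycle_def)

lemma twelve_cycle_mod:
  assumes "twelve_cycle c" shows "c (k mod 12) = c k" "c (k mod 12 + m) = c (k + m)"
  using assms by (simp_all add: twelve_cycle_eq_iff mod_simps)

lemma twelve_cycle_adjacent:
  assumes "twelve_cycle c" and "(i + 1) mod 12 = j mod 12 \<or> (j + 1) mod 12 = i mod 12"
  shows "E (c i) (c j)"
  using assms sym unfolding twelve_cycle_def by metis

lemma twelve_cycle_relative_index:
  assumes "twelve_cycle c"
  obtains d where "d < 12" "c k = c (i + d)"
proof
  show "(k + 11 * i) mod 12 < 12" by simp
  have "(i + (k + 11 * i) mod 12) mod 12 = (k + 12 * i) mod 12"
    by (simp add: mod_add_right_eq)
  then show "c k = c (i + (k + 11 * i) mod 12)"
    using assms by (simp add: twelve_cycle_eq_iff)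
qed

text \<open>
  These rules decide whether a list of explicitly indexed cycle vertices is a path. The last one
  restores the numeral \<open>2\<close>, since \<open>1 + 1\<close> as an index simplifies to \<open>Suc (Suc 0)\<close>.
\<close>

lemmas cycle_simps = gpath_def twelve_cycle_eq_iff twelve_cycle_adjacent numeral_2_eq_2[symmetric]

subsection \<open>Chords and outside vertices of a 12-cycle\<close>

text \<open>
  A chord of odd span \<open>d\<close> closes an even cycle of length \<open>d + 1\<close>. Two opposite vertices of it are joined
  by two paths of length \<open>(d + 1) / 2\<close>, and both can be prolonged by the same piece of the large cycle.
  A chord of span 4 cuts off a cycle of length 9.
\<close>

lemma no_chord_of_span_3_4_5:
  assumes "twelve_cycle c" "E (c 0) (c d)" "E (c d) (c 0)"
  shows "d \<noteq> 3" "d \<noteq> 4" "d \<noteq> 5"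
proof -
  show "d \<noteq> 3"
    using assms nine_path_unique[of "map c [6,7,8,9,10,11,0,3,2]" "map c [6,7,8,9,10,11,0,1,2]"]
    by (auto simp: cycle_simps)
  show "d \<noteq> 4"
    using assms no_nine_cycle[of "map c [4,5,6,7,8,9,10,11,0]"] by (auto simp: cycle_simps)
  show "d \<noteq> 5"
    using assms nine_path_unique[of "map c [7,8,9,10,11,0,5,4,3]" "map c [7,8,9,10,11,0,1,2,3]"]
    by (auto simp: cycle_simps)
qed

lemma chord_cases:
  assumes c: "twelve_cycle c" and e: "E (c i) (c (i + d))" and d: "d < 12"
  shows "d \<in> {1, 2, 6, 10, 11}"
proof -
  have "d \<notin> {3, 4, 5}"
    using no_chord_of_span_3_4_5[OF twelve_cycle_shift[OF c, of i], of d] e sym[OF e] by auto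
  moreover have "12 - d \<notin> {3, 4, 5}"
  proof -
    have "c (i + d + (12 - d)) = c i" using d c by (simp add: twelve_cycle_eq_iff)
    then show ?thesis
      using no_chord_of_span_3_4_5[OF twelve_cycle_shift[OF c, of "i + d"], of "12 - d"] e sym[OF e] by auto
  qed
  moreover have "d \<noteq> 0" using e irrefl by (metis add_0_right)
  ultimately show ?thesis using d by simp presburger
qed

lemma no_pendant_two_path:
  assumes c: "twelve_cycle c" and "x \<notin> range c" "y \<notin> range c" "E (c i) x" "E x y"
  shows False
proof -
  define b where "b = (\<lambda>j. c (i + j))"
  have b: "twelve_cycle b" unfolding b_def by (rule twelve_cycle_shift[OF c])
  have "x \<noteq> b j" "y \<noteq> b j" for j using assms by (auto simp: b_def)
  moreover have "x \<noteq> y" using assms irrefl by auto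
  moreover have "E (b 0) x" "E x (b 0)" "E x y" "E y x" using assms sym by (auto simp: b_def)
  ultimately show False
    using b nine_path_unique[of "y # x # map b [0,1,2,3,4,5,6]" "y # x # map b [0,11,10,9,8,7,6]"]
    by (auto simp: cycle_simps)
qed

text \<open>
  The nine-path from \<open>x\<close> to the cycle would otherwise reach the cycle after at least two vertices
  outside of it, which form a pendant path.
\<close>

lemma outside_adjacent_to_cycle:
  assumes c: "twelve_cycle c" and x: "x \<in> V" "x \<notin> range c"
  shows "\<exists>i. E x (c i)"
proof (cases "E x (c 0)")
  case False
  have first_hit: "\<exists>i. E (hd xs) (c i)"
    if "xs \<noteq> []" "successively E xs" "hd xs \<notin> range c" "last xs \<in> range c" for xs
    using that
  proof (induction xs rule: induct_list012)
    case (3 a b xs)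
    show ?case
    proof (cases "b \<in> range c")
      case False
      then obtain i where "E b (c i)" using 3 by auto
      then show ?thesis using no_pendant_two_path[OF c, of b a i] 3 False sym by auto
    qed (use 3 in auto)
  qed auto
  have "c 0 \<in> V" using c in_V unfolding twelve_cycle_def by blast
  then obtain xs where "gpath E xs" "length xs = 9" "hd xs = x" "last xs = c 0"
    using nine_path_exists[of x "c 0"] x False by auto
  moreover from this have "xs \<noteq> []" by auto
  ultimately show ?thesis using first_hit[of xs] x by (auto simp: gpath_def)
qed auto

text \<open>
  Two neighbours at even distance \<open>d\<close> lie with \<open>w\<close> on an even cycle of length \<open>d + 2\<close>, whose two halves
  can be prolonged as for chords. At distance 5, the detour through \<open>w\<close> closes a 9-cycle. At distance 3
  it can be used from either end of the arc between the neighbours.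
\<close>

lemma outside_neighbours_no_span_2_to_6:
  assumes c: "twelve_cycle c" and w: "w \<notin> range c" and e: "E w (c 0)" "E w (c d)"
  shows "d \<noteq> 2" "d \<noteq> 3" "d \<noteq> 4" "d \<noteq> 5" "d \<noteq> 6"
proof -
  have w': "w \<noteq> c j" "c j \<noteq> w" for j using w by auto
  note facts = c w' e e[THEN sym]
  show "d \<noteq> 2"
    using facts nine_path_unique[of "c 0 # w # map c [2,3,4,5,6,7,8]" "map c [0,1,2,3,4,5,6,7,8]"]
    by (auto simp: cycle_simps)
  show "d \<noteq> 3"
    using facts nine_path_unique[of "map c [1,2,3] @ w # map c [0,11,10,9,8]"
        "map c [1,0] @ w # map c [3,4,5,6,7,8]"]
    by (auto simp: cycle_simps)
  show "d \<noteq> 4"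
    using facts nine_path_unique[of "map c [7,8,9,10,11,0] @ w # map c [4,3]"
        "map c [7,8,9,10,11,0,1,2,3]"]
    by (auto simp: cycle_simps)
  show "d \<noteq> 5"
    using facts no_nine_cycle[of "w # map c [5,6,7,8,9,10,11,0]"]
    by (auto simp: cycle_simps)
  show "d \<noteq> 6"
    using facts nine_path_unique[of "map c [8,9,10,11,0] @ w # map c [6,5,4]"
        "map c [8,9,10,11,0,1,2,3,4]"]
    by (auto simp: cycle_simps)
qed

lemma outside_neighbour_distance:
  assumes c: "twelve_cycle c" and w: "w \<notin> range c"
    and e: "E w (c i)" "E w (c (i + d))" and d: "d < 12"
  shows "d \<in> {0, 1, 11}"
proof -
  have "d \<notin> {2, 3, 4, 5, 6}"
    using outside_neighbours_no_span_2_to_6[OF twelve_cycle_shift[OF c, of i], of w d] e w by auto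
  moreover have "12 - d \<notin> {2, 3, 4, 5, 6}"
  proof -
    have "c (i + d + (12 - d)) = c i" using d c by (simp add: twelve_cycle_eq_iff)
    then show ?thesis
      using outside_neighbours_no_span_2_to_6[OF twelve_cycle_shift[OF c, of "i + d"], of w "12 - d"] e w
      by auto
  qed
  ultimately show ?thesis using d by simp presburger
qed

definition ear :: "(nat \<Rightarrow> 'a) \<Rightarrow> 'a \<Rightarrow> nat \<Rightarrow> bool" where
  "ear c w i \<longleftrightarrow> w \<notin> range c \<and> (\<forall>y. E w y \<longleftrightarrow> y = c i \<or> y = c (i + 1))"

text \<open>
  Two neighbours of \<open>w\<close> on the cycle are consecutive. A third one would have to be consecutive to both
  of them, which is impossible on a cycle longer than a triangle.
\<close>

lemma outside_is_ear:
  assumes c: "twelve_cycle c" and w: "w \<in> V" "w \<notin> range c"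
  shows "\<exists>i<12. ear c w i"
proof -
  obtain j where j: "E w (c j)" using outside_adjacent_to_cycle[OF c w] by blast
  have on_cycle: "y \<in> range c" if "E w y" for y
    using no_pendant_two_path[OF c w(2) _ sym[OF j] that] by blast
  obtain z where z: "z \<noteq> c j" "E w z" using other_neighbour[OF j] by blast
  from on_cycle[OF z(2)] obtain k where k: "z = c k" by blast
  obtain d where d: "d < 12" "z = c (j + d)"
    using twelve_cycle_relative_index[OF c, of k j] k by metis
  have "d \<in> {0, 1, 11}" using outside_neighbour_distance[OF c w(2) j _ d(1)] z d by simp
  moreover have "d \<noteq> 0" using z d by (metis add_0_right)
  moreover have "c (j + 11 + 1) = c j" using c by (simp add: twelve_cycle_eq_iff)
  ultimately obtain i where i: "E w (c i)" "E w (c (i + 1))" using j z d by fastforce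
  have "y = c i \<or> y = c (i + 1)" if y: "E w y" for y
  proof -
    from on_cycle[OF y] obtain k where k: "y = c k" by blast
    obtain d where d: "d < 12" "y = c (i + d)"
      using twelve_cycle_relative_index[OF c, of k i] k by metis
    have "d \<in> {0, 1, 11}" using outside_neighbour_distance[OF c w(2) i(1) _ d(1)] y d by simp
    moreover have "d \<noteq> 11"
    proof
      assume "d = 11"
      then have "E w (c (i + 1 + 10))" using y d by (simp add: add.commute)
      then show False using outside_neighbour_distance[OF c w(2) i(2), of 10] by simp
    qed
    ultimately show ?thesis using d by auto
  qed
  then have "ear c w i" using i w by (auto simp: ear_def)
  then have "ear c w (i mod 12)" unfolding ear_def twelve_cycle_mod[OF c] .
  then show ?thesis by (intro exI[of _ "i mod 12"]) simp
qed

subsection \<open>Mutual exclusion of short chords, diagonals and ears\<close>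

text \<open>
  The arc from \<open>c 0\<close> to \<open>c 9\<close> contains both short chords. It has length 9, and each of the chords
  shortens it to 8 by leaving out the vertex that it skips.
\<close>

lemma near_short_chords_unique:
  assumes "twelve_cycle c" "E (c 0) (c 2)" "E (c k) (c (k + 2))" "k < 8"
  shows "k = 0"
proof (rule ccontr)
  assume "k \<noteq> 0"
  then have "k \<in> {1,2,3,4,5,6,7}" using assms by auto
  then show False
    using assms nine_path_unique[of "map c [0,2,3,4,5,6,7,8,9]"
        "map c (filter (\<lambda>i. i \<noteq> k + 1) [0,1,2,3,4,5,6,7,8,9])"]
    by (elim insertE emptyE) (simp_all add: cycle_simps)
qed

lemma short_chords_unique:
  assumes c: "twelve_cycle c" and e: "E (c 0) (c 2)" "E (c k) (c (k + 2))" and k: "k < 12"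
  shows "k = 0"
proof (cases "k < 8")
  case True
  then show ?thesis using near_short_chords_unique assms by blast
next
  case False
  have "c (k + (12 - k)) = c 0" "c (k + (12 - k + 2)) = c 2"
    using c k by (simp_all add: twelve_cycle_eq_iff)
  then have "12 - k = 0"
    using e k False by (intro near_short_chords_unique[OF twelve_cycle_shift[OF c, of k]]) simp_all
  then show ?thesis using k by simp
qed

text \<open>
  On an arc of length 8 that contains both, the short chord and the ear together leave the length
  unchanged: this gives a second path of length 8. If the ear sits on the triangle \<open>c 0, c 1, c 2\<close>,
  then \<open>w\<close> is joined to a vertex of the triangle by two paths of length 3 through the other two.
\<close>

lemma no_short_chord_and_ear:
  assumes c: "twelve_cycle c" and e: "E (c 0) (c 2)" "ear c w k" and k: "k < 12"
  shows False
proof -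
  have k_cases: "k \<in> {0,1,2,3,4,5,6,7,8,9,10,11}" using k by simp presburger
  have w: "w \<noteq> c j" "c j \<noteq> w" for j using e by (auto simp: ear_def)
  have e': "E (c 2) (c 0)" "E w (c k)" "E (c k) w" "E w (c (k + 1))" "E (c (k + 1)) w"
    using e sym by (auto simp: ear_def)
  have wrap: "c 12 = c 0" "c 13 = c 1" using c by (simp_all add: twelve_cycle_eq_iff)
  note facts = c e(1) e' w wrap
  consider "k = 0" | "k = 1" | "k \<in> {2,3,4,5,6,7}" | "k \<in> {8,9,10,11}" using k_cases by auto
  then show False
  proof cases
    case 1
    then show ?thesis
      using facts nine_path_unique[of "w # map c [0,1,2,3,4,5,6,7]" "w # map c [1,0,2,3,4,5,6,7]"]
      by (simp add: cycle_simps)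
  next
    case 2
    then show ?thesis
      using facts nine_path_unique[of "w # map c [2,1,0,11,10,9,8,7]" "w # map c [1,2,0,11,10,9,8,7]"]
      by (simp add: cycle_simps)
  next
    case 3
    then show ?thesis
      using facts nine_path_unique[of "map c [0,1,2,3,4,5,6,7,8]"
          "map c (0 # filter (\<lambda>i. i \<le> k) [2,3,4,5,6,7,8]) @ w #
             map c (filter (\<lambda>i. k < i) [3,4,5,6,7,8])"]
      by (elim insertE emptyE) (simp_all add: cycle_simps)
  next
    case 4
    then show ?thesis
      using facts nine_path_unique[of "map c [6,7,8,9,10,11,0,1,2]"
          "map c (filter (\<lambda>i. i \<le> k) [6,7,8,9,10,11]) @ w #
             map c (filter (\<lambda>i. k < i) [9,10,11] @ [0, 2])"]
      by (elim insertE emptyE) (simp_all add: cycle_simps)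
  qed
qed

text \<open>
  The arc from \<open>c 0\<close> to \<open>c 7\<close> has length 7, and each of the ears lengthens it to 8.
\<close>

lemma near_ears_unique:
  assumes c: "twelve_cycle c" and e: "ear c w 0" "ear c w' k" and k: "k < 7"
  shows "w = w'"
proof (rule ccontr)
  assume neq: "w \<noteq> w'"
  have w: "w \<noteq> c j" "c j \<noteq> w" "w' \<noteq> c j" "c j \<noteq> w'" for j using e by (auto simp: ear_def)
  have e': "E w (c 0)" "E (c 0) w" "E w (c 1)" "E (c 1) w"
     "E w' (c k)" "E (c k) w'" "E w' (c (k + 1))" "E (c (k + 1)) w'"
    using e sym by (auto simp: ear_def)
  have "k \<in> {0,1,2,3,4,5,6}" using k by auto
  then show False
    using c neq e' w nine_path_unique[of "c 0 # w # map c [1,2,3,4,5,6,7]"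
          "map c (filter (\<lambda>i. i \<le> k) [0,1,2,3,4,5,6]) @ w' #
             map c (filter (\<lambda>i. k < i) [1,2,3,4,5,6,7])"]
      by (elim insertE emptyE) (simp_all add: cycle_simps)
qed

lemma ears_unique:
  assumes c: "twelve_cycle c" and e: "ear c w 0" "ear c w' k" and k: "k < 12"
  shows "w = w'"
proof (cases "k < 7")
  case True
  then show ?thesis using near_ears_unique assms by blast
next
  case False
  let ?b = "\<lambda>i. c (k + i)"
  have "?b (12 - k) = c 0" "?b (12 - k + 1) = c 1"
    using c k by (simp_all add: twelve_cycle_eq_iff)
  then have "ear ?b w (12 - k)" "ear ?b w' 0"
    using e unfolding ear_def by auto
  then show ?thesis
    using near_ears_unique[OF twelve_cycle_shift[OF c, of k], of w' w "12 - k"] False k by auto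
qed

text \<open>
  For \<open>0 < k < 4\<close> the vertices \<open>c 4\<close> and \<open>c 10\<close> are joined by two paths that use both diagonals: one
  traverses the arc from \<open>c 0\<close> to \<open>c k\<close>, the other one the opposite arc from \<open>c (k + 6)\<close> to \<open>c 6\<close>.
  The remaining \<open>k\<close> reduce to this when the other diagonal is moved to the origin.
\<close>

lemma diagonals_unique:
  assumes c: "twelve_cycle c" and e: "E (c 0) (c 6)" "E (c k) (c (k + 6))" and k: "k < 6"
  shows "k = 0"
proof -
  have small: False
    if b: "twelve_cycle b" "E (b 0) (b 6)" "E (b k) (b (k + 6))" and k: "k \<in> {1,2,3}" for b k
  proof -
    note rev = b(2)[THEN sym] b(3)[THEN sym]
    show False
      using k b rev nine_path_unique[of
          "map b (filter (\<lambda>i. k \<le> i) [4,3,2,1] @ filter (\<lambda>i. i \<le> k + 6) [9,8,7,6] @ [0,11,10])"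
          "map b ([4,5,6] @ filter (\<lambda>i. i \<le> k) [0,1,2,3] @ filter (\<lambda>i. k + 6 \<le> i) [7,8,9,10])"]
      by (elim insertE emptyE) (simp_all add: cycle_simps)
  qed
  show ?thesis
  proof (rule ccontr)
    assume "k \<noteq> 0"
    then consider "k \<in> {1,2,3}" | "6 - k \<in> {1,2,3}" using k by force
    then show False
    proof cases
      case 1
      then show ?thesis using small c e by blast
    next
      case 2
      have "c (k + (6 - k)) = c 6" "c (k + (6 - k + 6)) = c 0"
        using c k by (simp_all add: twelve_cycle_eq_iff)
      then show ?thesis
        using small[OF twelve_cycle_shift[OF c, of k] _ _ 2] e(2) e(1)[THEN sym] by simp
    qed
  qed
qed

text \<open>
  The paths \<open>2, 1, 0, 6, \<dots>, 11\<close> and \<open>8, 7, 6, 0, \<dots>, 5\<close> have length 8, and the arcs \<open>2, \<dots>, 11\<close> and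
  \<open>8, \<dots>, 17\<close> with the same ends have length 9. Any short chord lies on one of these arcs and shortens
  it to length 8.
\<close>

lemma no_short_chord_and_diagonal:
  assumes c: "twelve_cycle c" and diag: "E (c 0) (c 6)" and short: "E (c m) (c (m + 2))"
  shows False
proof -
  define k where "k = m mod 12"
  have k: "k < 12" by (simp add: k_def)
  have e: "E (c 0) (c 6)" "E (c k) (c (k + 2))"
    using diag short by (simp_all only: k_def twelve_cycle_mod[OF c])
  have k_cases: "k \<in> {0,1,2,3,4,5,6,7,8,9,10,11}" using k by simp presburger
  have wrap: "c 12 = c 0" "c 13 = c 1" using c by (simp_all add: twelve_cycle_eq_iff)
  note facts = c e e[THEN sym] wrap
  consider "k \<in> {2,3,4,5,6,7,8,9}" | "k \<in> {0,1}" | "k \<in> {10,11}" using k_cases by auto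
  then show False
  proof cases
    case 1
    then show ?thesis
      using facts nine_path_unique[of "map c [2,1,0,6,7,8,9,10,11]"
          "map c (filter (\<lambda>i. i \<noteq> k + 1) [2,3,4,5,6,7,8,9,10,11])"]
      by (elim insertE emptyE) (simp_all add: cycle_simps)
  next
    case 2
    then show ?thesis
      using facts nine_path_unique[of "map c [8,7,6,0,1,2,3,4,5]"
          "map c (filter (\<lambda>i. i \<noteq> k + 1) [8,9,10,11,0,1,2,3,4,5])"]
      by (elim insertE emptyE) (simp_all add: cycle_simps)
  next
    case 3
    then show ?thesis
      using facts nine_path_unique[of "map c [8,7,6,0,1,2,3,4,5]"
          "map c (filter (\<lambda>i. i \<noteq> (k + 1) mod 12) [8,9,10,11,0,1,2,3,4,5])"]
      by (elim insertE emptyE) (simp_all add: cycle_simps)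
  qed
qed

text \<open>
  The paths \<open>3, 2, 1, 0, 6, \<dots>, 10\<close> and \<open>9, 8, 7, 6, 0, \<dots>, 4\<close> have length 8, and the arcs \<open>3, \<dots>, 10\<close>
  and \<open>9, \<dots>, 16\<close> with the same ends have length 7. Any ear sits on one of these arcs and lengthens it
  to length 8.
\<close>

lemma no_diagonal_and_ear:
  assumes c: "twelve_cycle c" and e: "E (c 0) (c 6)" "ear c w k" and k: "k < 12"
  shows False
proof -
  have k_cases: "k \<in> {0,1,2,3,4,5,6,7,8,9,10,11}" using k by simp presburger
  have w: "w \<noteq> c j" "c j \<noteq> w" for j using e by (auto simp: ear_def)
  have e': "E (c 6) (c 0)" "E w (c k)" "E (c k) w" "E w (c (k + 1))" "E (c (k + 1)) w"
    using e sym by (auto simp: ear_def)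
  have wrap: "c 12 = c 0" "c 13 = c 1" using c by (simp_all add: twelve_cycle_eq_iff)
  note facts = c e(1) e' w wrap
  consider "k \<in> {3,4,5,6,7,8,9}" | "k \<in> {0,1,2}" | "k \<in> {10,11}" using k_cases by auto
  then show False
  proof cases
    case 1
    then show ?thesis
      using facts nine_path_unique[of "map c [3,2,1,0,6,7,8,9,10]"
          "map c (filter (\<lambda>i. i \<le> k) [3,4,5,6,7,8,9]) @ w #
             map c (filter (\<lambda>i. k < i) [4,5,6,7,8,9,10])"]
      by (elim insertE emptyE) (simp_all add: cycle_simps)
  next
    case 2
    then show ?thesis
      using facts nine_path_unique[of "map c [9,8,7,6,0,1,2,3,4]"
          "map c ([9,10,11] @ filter (\<lambda>i. i \<le> k) [0,1,2]) @ w #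
             map c (filter (\<lambda>i. k < i) [1,2,3,4])"]
      by (elim insertE emptyE) (simp_all add: cycle_simps)
  next
    case 3
    then show ?thesis
      using facts nine_path_unique[of "map c [9,8,7,6,0,1,2,3,4]"
          "map c (filter (\<lambda>i. i \<le> k) [9,10,11]) @ w #
             map c (filter (\<lambda>i. k < i) [11] @ [0,1,2,3,4])"]
      by (elim insertE emptyE) (simp_all add: cycle_simps)
  qed
qed

subsection \<open>The remaining graphs have a pair without a nine-path\<close>

text \<open>
  The map \<open>f\<close> labels vertices by numbers, and \<open>N\<close> is an upper bound for the neighbourhoods in terms of
  labels. Since \<open>f\<close> may identify labels, a path may have several labellings; the enumeration covers
  at least one of them, because a repeated label means a repeated vertex.
\<close>

lemma path_end_in_path_ends:
  assumes N: "\<And>k y. k \<in> K \<Longrightarrow> E (f k) y \<Longrightarrow> \<exists>l \<in> set (N k) \<inter> K. y = f l"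
    and "k \<in> K" "gpath E (f k # xs)" "set xs \<inter> f ` set ks = {}"
  shows "\<exists>l \<in> set (path_ends N (length xs) (k # ks)) \<inter> K. last (f k # xs) = f l"
  using assms(2-)
proof (induction xs arbitrary: k ks)
  case Nil
  then show ?case by simp
next
  case (Cons y ys)
  then have "E (f k) y" by (simp add: gpath_def)
  then obtain l where l: "l \<in> set (N k)" "l \<in> K" "y = f l" using N Cons.prems(1) by blast
  have "gpath E (f l # ys)" "set ys \<inter> f ` set (k # ks) = {}"
    using Cons.prems l by (auto simp: gpath_def)
  from Cons.IH[OF l(2) this] obtain m where
    m: "m \<in> set (path_ends N (length ys) (l # k # ks))" "m \<in> K" "last (f l # ys) = f m"
    by blast
  have "l \<notin> set (k # ks)" using Cons.prems l by (auto simp: gpath_def)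
  then have "m \<in> set (path_ends N (length (y # ys)) (k # ks))" using l(1) m(1) by auto
  then show ?case using m l by auto
qed

lemma no_nine_path:
  assumes N: "\<And>k y. k \<in> K \<Longrightarrow> E (f k) y \<Longrightarrow> \<exists>l \<in> set (N k) \<inter> K. y = f l"
    and "s \<in> K" "\<And>l. l \<in> K \<Longrightarrow> f l = f t \<Longrightarrow> l = t" "t \<notin> set (path_ends N 8 [s])"
    and xs: "gpath E xs" "length xs = 9" "hd xs = f s"
  shows "last xs \<noteq> f t"
proof -
  obtain ys where ys: "xs = f s # ys" "length ys = 8"
    using xs by (cases xs) auto
  then show ?thesis
    using path_end_in_path_ends[of K f N s ys "[]"] assms by auto
qed

lemma cycle_neighbour_cases:
  assumes c: "twelve_cycle c" and e: "E (c k) y" and y: "y \<in> range c"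
  obtains (step) "y = c ((k + 1) mod 12) \<or> y = c ((k + 11) mod 12)"
    | (short_from) "y = c (k + 2)" "E (c k) (c (k + 2))"
    | (short_to) i where "y = c i" "c (i + 2) = c k" "E (c i) (c (i + 2))"
    | (diagonal) "y = c (k + 6)" "E (c k) (c (k + 6))"
proof -
  obtain m where m: "y = c m" using y by blast
  obtain d where d: "d < 12" "y = c (k + d)"
    using twelve_cycle_relative_index[OF c, of m k] m by metis
  have "d \<in> {1, 2, 6, 10, 11}" using chord_cases[OF c _ d(1)] e d by simp
  moreover have "c (k + 10 + 2) = c k" using c by (simp add: twelve_cycle_eq_iff)
  ultimately show thesis
    using that d e e[THEN sym] twelve_cycle_mod(1)[OF c] by (elim insertE emptyE) metis+
qed

lemma nine_path_between_cycle_vertices: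
  assumes c: "twelve_cycle c" and d: "d \<in> {3, 5}"
  obtains xs where "gpath E xs" "length xs = 9" "hd xs = c i" "last xs = c (i + d)"
proof -
  have "\<not> E (c i) (c (i + d))" using chord_cases[OF c, of i d] d by auto
  moreover have "c i \<noteq> c (i + d)"
  proof
    assume "c i = c (i + d)"
    then have "(i + d - i) mod 12 = 0"
      using c by (metis twelve_cycle_eq_iff mod_eq_dvd_iff_nat dvd_imp_mod_0 le_add1)
    then show False using d by auto
  qed
  moreover have "c j \<in> V" for j using c in_V unfolding twelve_cycle_def by blast
  ultimately show thesis using that nine_path_exists by metis
qed

text \<open>
  A short chord excludes all other short chords, diagonals and ears, so that the graph is a 12-cycle
  with a single chord.
\<close>

lemma no_short_chord:
  assumes c: "twelve_cycle c"
  shows "\<not> E (c i) (c (i + 2))"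
proof
  assume "E (c i) (c (i + 2))"
  define b where "b = (\<lambda>j. c (i + j))"
  have b: "twelve_cycle b" unfolding b_def by (rule twelve_cycle_shift[OF c])
  have short: "E (b 0) (b 2)" using \<open>E (c i) (c (i + 2))\<close> by (simp add: b_def)
  have V: "y \<in> range b" if "y \<in> V" for y
    using outside_is_ear[OF b that] no_short_chord_and_ear[OF b short] by blast
  have short_only: "k mod 12 = 0" if "E (b k) (b (k + 2))" for k
  proof (rule short_chords_unique[OF b short])
    show "E (b (k mod 12)) (b (k mod 12 + 2))" unfolding twelve_cycle_mod[OF b] by (rule that)
  qed simp
  have no_diagonal: "\<not> E (b k) (b (k + 6))" if "k < 12" for k
  proof
    assume diag: "E (b k) (b (k + 6))"
    have "b (k + (12 - k)) = b 0" "b (k + (12 - k + 2)) = b 2"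
      using that b by (simp_all add: twelve_cycle_eq_iff)
    then show False
      using no_short_chord_and_diagonal[OF twelve_cycle_shift[OF b, of k], of "12 - k"] diag short
      by simp
  qed
  have "\<exists>l \<in> set (cycle_plus_edge 2 k) \<inter> {..<12}. y = b l"
    if k: "k \<in> {..<12}" and e: "E (b k) y" for k y
    using b e V[OF in_V[OF e[THEN sym]]]
  proof (cases rule: cycle_neighbour_cases)
    case step
    then show ?thesis by (auto simp: cycle_plus_edge_def)
  next
    case short_from
    then have "k = 0" "y = b 2" using short_only[of k] k by (simp_all add: numeral_2_eq_2)
    then show ?thesis by (auto simp: cycle_plus_edge_def)
  next
    case (short_to i)
    then have "i mod 12 = 0" "(i + 2) mod 12 = k"
      using short_only[of i] k b by (simp_all add: twelve_cycle_eq_iff)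
    moreover from this have "k = 2" by presburger
    ultimately show ?thesis
      using short_to twelve_cycle_mod(1)[OF b, of i] by (auto simp: cycle_plus_edge_def)
  next
    case diagonal
    then show ?thesis using no_diagonal k by auto
  qed
  moreover note nine_paths_miss_vertex(1)
  moreover obtain xs where "gpath E xs" "length xs = 9" "hd xs = b 4" "last xs = b (4 + 5)"
    using nine_path_between_cycle_vertices[OF b, of 5 4] by auto
  ultimately show False
    using no_nine_path[of "{..<12}" b "cycle_plus_edge 2" 4 9 xs] b
    by (auto simp: twelve_cycle_eq_iff)
qed

text \<open>
  With short chords ruled out, a diagonal excludes everything else: the graph is a 12-cycle with a
  single diagonal.
\<close>

lemma no_diagonal:
  assumes c: "twelve_cycle c"
  shows "\<not> E (c i) (c (i + 6))"
proof
  assume "E (c i) (c (i + 6))"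
  define b where "b = (\<lambda>j. c (i + j))"
  have b: "twelve_cycle b" unfolding b_def by (rule twelve_cycle_shift[OF c])
  have diag: "E (b 0) (b 6)" using \<open>E (c i) (c (i + 6))\<close> by (simp add: b_def)
  have V: "y \<in> range b" if "y \<in> V" for y
    using outside_is_ear[OF b that] no_diagonal_and_ear[OF b diag] by blast
  have diag_only: "k = 0 \<or> k = 6" if e: "E (b k) (b (k + 6))" and k: "k < 12" for k
  proof (cases "k < 6")
    case True
    then show ?thesis using diagonals_unique[OF b diag e] by simp
  next
    case False
    then have "b (k + 6) = b (k - 6)" "b k = b (k - 6 + 6)"
      using k b by (simp_all add: twelve_cycle_eq_iff mod_if)
    then have "E (b (k - 6)) (b (k - 6 + 6))" using e[THEN sym] by metis
    then have "k - 6 = 0" using k by (intro diagonals_unique[OF b diag]) simp_all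
    then show ?thesis using False by simp
  qed
  have "\<exists>l \<in> set (cycle_plus_edge 6 k) \<inter> {..<12}. y = b l"
    if k: "k \<in> {..<12}" and e: "E (b k) y" for k y
    using b e V[OF in_V[OF e[THEN sym]]]
  proof (cases rule: cycle_neighbour_cases)
    case step
    then show ?thesis by (auto simp: cycle_plus_edge_def)
  next
    case diagonal
    moreover have "b 12 = b 0" using b by (simp add: twelve_cycle_eq_iff)
    ultimately show ?thesis using diag_only[of k] k by (auto simp: cycle_plus_edge_def)
  qed (use no_short_chord[OF b] in blast)+
  moreover note nine_paths_miss_vertex(2)
  moreover obtain xs where "gpath E xs" "length xs = 9" "hd xs = b 1" "last xs = b (1 + 3)"
    using nine_path_between_cycle_vertices[OF b, of 3 1] by auto
  ultimately show False
    using no_nine_path[of "{..<12}" b "cycle_plus_edge 6" 1 4 xs] b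
    by (auto simp: twelve_cycle_eq_iff)
qed

text \<open>
  Only ears are left, and there is at most one of them.
\<close>

theorem no_twelve_cycle: "\<not> twelve_cycle c"
proof
  assume c: "twelve_cycle c"
  \<comment> \<open>If there is an ear, the cycle is shifted such that it sits at \<open>0\<close>; otherwise \<open>w\<close> is arbitrary.\<close>
  obtain b w where b: "twelve_cycle b" and w: "\<And>v k. ear b v k \<Longrightarrow> ear b w 0"
  proof (cases "\<exists>v k. ear c v k")
    case True
    then obtain v k where "ear c v k" by blast
    then have "ear (\<lambda>j. c (k + j)) v 0" by (auto simp: ear_def)
    then show thesis using that twelve_cycle_shift[OF c] by blast
  qed (use c that in blast)
  have ear_only: "v = w \<and> ear b w 0" if "v \<in> V" "v \<notin> range b" for v
    using outside_is_ear[OF b that] w ears_unique[OF b] by blast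
  define f where "f k = (if k = 12 then w else b k)" for k :: nat
  \<comment> \<open>The label \<open>12\<close> stands for the ear and is in use only if there is one.\<close>
  define K where "K = {k :: nat. k < 12 \<or> k = 12 \<and> ear b w 0}"
  have "\<exists>l \<in> set (cycle_plus_ear k) \<inter> K. y = f l" if k: "k \<in> K" and e: "E (f k) y" for k y
  proof (cases "k = 12")
    case True
    then have "y = b 0 \<or> y = b 1" using k e by (auto simp: f_def K_def ear_def)
    then show ?thesis using True by (auto simp: f_def K_def cycle_plus_ear_def)
  next
    case False
    then have k12: "k < 12" and e': "E (b k) y" using k e by (auto simp: f_def K_def)
    show ?thesis
    proof (cases "y \<in> range b")
      case True
      with b e' show ?thesis
      proof (cases rule: cycle_neighbour_cases)
        case step
        have "(k + 1) mod 12 < 12" "(k + 11) mod 12 < 12" by simp_all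
        then show ?thesis using False step by (auto simp: f_def K_def cycle_plus_ear_def)
      qed (use no_short_chord[OF b] no_diagonal[OF b] in blast)+
    next
      case y: False
      then have ear: "y = w" "ear b w 0" using ear_only in_V[OF e'[THEN sym]] by blast+
      then have "b k = b 0 \<or> b k = b 1" using e'[THEN sym] by (auto simp: ear_def)
      then have "k = 0 \<or> k = 1" using b k12 by (simp add: twelve_cycle_eq_iff)
      then show ?thesis using ear by (auto simp: f_def K_def cycle_plus_ear_def)
    qed
  qed
  moreover note nine_paths_miss_vertex(3)
  moreover obtain xs where "gpath E xs" "length xs = 9" "hd xs = b 3" "last xs = b (3 + 3)"
    using nine_path_between_cycle_vertices[OF b, of 3 3] by auto
  moreover have "l = 6" if "l \<in> K" "f l = f 6" for l
    using that b by (auto simp: f_def K_def ear_def twelve_cycle_eq_iff split: if_splits)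
  ultimately show False
    using no_nine_path[of K f cycle_plus_ear 3 6 xs] by (auto simp: f_def K_def)
qed

end

section \<open>Cycles as lists of vertices\<close>

text \<open>
  The arcs of the closed walk that visits the vertices \<open>xs\<close> in this order and returns to the start.
\<close>

definition cyclic_arcs :: "'a list \<Rightarrow> ('a \<times> 'a) list" where
  "cyclic_arcs xs = zip xs (rotate1 xs)"

lemma length_cyclic_arcs [simp]: "length (cyclic_arcs xs) = length xs"
  by (simp add: cyclic_arcs_def)

lemma cyclic_arcs_nth:
  "i < length xs \<Longrightarrow> cyclic_arcs xs ! i = (xs ! i, xs ! (Suc i mod length xs))"
  by (simp add: cyclic_arcs_def nth_rotate1)

lemma set_cyclic_arcs:
  "set (cyclic_arcs xs) = (\<lambda>i. (xs ! i, xs ! (Suc i mod length xs))) ` {..<length xs}"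
  by (auto simp: set_conv_nth cyclic_arcs_nth image_iff)
     (metis cyclic_arcs_nth length_cyclic_arcs)+

lemma cyclic_arcs_subset_iff:
  assumes "xs \<noteq> []"
  shows "set (cyclic_arcs xs) \<subseteq> A \<longleftrightarrow>
    successively (\<lambda>x y. (x, y) \<in> A) xs \<and> (last xs, hd xs) \<in> A"
proof -
  have "set (zip (u # us) (us @ [w])) \<subseteq> A \<longleftrightarrow>
      successively (\<lambda>x y. (x, y) \<in> A) (u # us) \<and> (last (u # us), w) \<in> A" for u us w
    by (induction us arbitrary: u) auto
  then show ?thesis using assms by (cases xs) (simp_all add: cyclic_arcs_def)
qed

lemma set_cyclic_arcs_rotate:
  "set (cyclic_arcs (rotate k xs)) = set (cyclic_arcs xs)"
proof -
  have "cyclic_arcs (rotate1 ys) = rotate1 (cyclic_arcs ys)" for ys :: "'a list"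
  proof (cases ys rule: remdups_adj.cases)
    case (3 a b as)
    have "zip ((b # as) @ [a]) ((as @ [a]) @ [b]) = zip (b # as) (as @ [a]) @ zip [a] [b]"
      by (rule zip_append) simp
    then show ?thesis using 3 by (simp add: cyclic_arcs_def)
  qed (simp_all add: cyclic_arcs_def)
  then show ?thesis by (induction k) auto
qed

text \<open>
  On a closed list of two vertices both arcs have the same edge; from three vertices on, the edges are
  pairwise distinct, so that the length of the list is the number of edges.
\<close>

lemma cyclic_edge_eq_imp_index_eq:
  assumes "distinct xs" "3 \<le> length xs" "i < length xs" "j < length xs"
    and "{xs ! i, xs ! (Suc i mod length xs)} = {xs ! j, xs ! (Suc j mod length xs)}"
  shows "i = j"
proof (rule ccontr)
  assume "i \<noteq> j"
  have succ: "Suc m mod length xs = (if Suc m = length xs then 0 else Suc m)" if "m < length xs" for m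
    using that by (simp add: mod_Suc)
  have "Suc i mod length xs < length xs" "Suc j mod length xs < length xs"
    using assms by (auto intro: mod_less_divisor)
  then have "i = Suc j mod length xs" "j = Suc i mod length xs"
    using assms \<open>i \<noteq> j\<close> by (auto simp: doubleton_eq_iff nth_eq_iff_index_eq)
  then have "i = Suc j \<or> i = 0 \<and> Suc j = length xs"
    "j = Suc i \<or> j = 0 \<and> Suc i = length xs"
    using succ[OF assms(3)] succ[OF assms(4)] by metis+
  then show False using assms(2) by linarith
qed

lemma card_cyclic_edges:
  assumes "distinct xs" "3 \<le> length xs"
  shows "card (arc_edge ` set (cyclic_arcs xs)) = length xs"
proof -
  have "inj_on (\<lambda>i. {xs ! i, xs ! (Suc i mod length xs)}) {..<length xs}"
    using cyclic_edge_eq_imp_index_eq[OF assms] by (intro inj_onI) auto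
  then show ?thesis
    by (simp add: set_cyclic_arcs image_image arc_edge_def card_image)
qed

lemma pcas_iff: "pcas u p v \<longleftrightarrow> u # map snd p = map fst p @ [v]"
  by (induction p arbitrary: u) auto

text \<open>
  The first components of the arcs of a cycle list its vertices, and the second components are the same
  list rotated by one.
\<close>

lemma ucycle_iff:
  assumes "pair_wf_digraph G"
  shows "ucycle G C \<longleftrightarrow> (\<exists>xs. distinct xs \<and> 3 \<le> length xs \<and>
    set (cyclic_arcs xs) \<subseteq> parcs G \<and> C = arc_edge ` set (cyclic_arcs xs))"
proof -
  interpret pair_wf_digraph G by fact
  have cycle_iff: "cycle p \<longleftrightarrow> (\<exists>xs. distinct xs \<and> xs \<noteq> [] \<and> p = cyclic_arcs xs \<and> set p \<subseteq> parcs G)" for p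
  proof
    assume "cycle p"
    then obtain u where u: "set p \<subseteq> parcs G" "pcas u p u" "distinct (tl (pawalk_verts u p))" "p \<noteq> []"
      unfolding cycle_def awalk_def by auto
    then have snd: "map snd p = rotate1 (map fst p)" by (cases p) (auto simp: pcas_iff)
    have "distinct (map snd p)"
      using u awalk_verts_conv'[of u p u] by auto
    then have "distinct (map fst p)" unfolding snd by simp
    moreover have "p = cyclic_arcs (map fst p)"
      unfolding cyclic_arcs_def snd[symmetric] by (simp add: zip_map_fst_snd)
    ultimately show "\<exists>xs. distinct xs \<and> xs \<noteq> [] \<and> p = cyclic_arcs xs \<and> set p \<subseteq> parcs G"
      using u by (intro exI[of _ "map fst p"]) auto
  next
    assume "\<exists>xs. distinct xs \<and> xs \<noteq> [] \<and> p = cyclic_arcs xs \<and> set p \<subseteq> parcs G"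
    then obtain u us where xs: "distinct (u # us)" "p = cyclic_arcs (u # us)" "set p \<subseteq> parcs G"
      by (metis list.exhaust)
    have fst: "map fst p = u # us" and snd: "map snd p = us @ [u]"
      using xs by (simp_all add: cyclic_arcs_def)
    have "pcas u p u" by (simp add: pcas_iff fst snd)
    moreover have "p \<noteq> []" using fst by auto
    moreover have "u \<in> pverts G"
      using \<open>p \<noteq> []\<close> fst xs(3) in_arcsD1 by (cases p) auto
    ultimately show "cycle p"
      using xs snd awalk_verts_conv'[of u p u] unfolding cycle_def awalk_def by auto
  qed
  show ?thesis unfolding ucycle_def cycle_iff
    by (metis length_cyclic_arcs list.size(3) not_numeral_le_zero)
qed

lemma cycle_of_path:
  fixes G :: "'a pair_pre_digraph"
  assumes "pair_wf_digraph G" "gpath (\<lambda>x y. (x, y) \<in> parcs G) xs" "3 \<le> length xs"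
    and "(last xs, hd xs) \<in> parcs G"
  shows "ucycle G (arc_edge ` set (cyclic_arcs xs))"
    "card (arc_edge ` set (cyclic_arcs xs)) = length xs"
proof -
  have "xs \<noteq> []" using assms by auto
  then have "set (cyclic_arcs xs) \<subseteq> parcs G"
    using assms cyclic_arcs_subset_iff unfolding gpath_def by blast
  then show "ucycle G (arc_edge ` set (cyclic_arcs xs))"
    using assms by (auto simp: ucycle_iff gpath_def)
  show "card (arc_edge ` set (cyclic_arcs xs)) = length xs"
    using assms by (auto simp: gpath_def card_cyclic_edges)
qed

text \<open>
  A cycle through the edge between the ends can be read off in one way only, starting at the first
  vertex and with the given last vertex: the successor of each vertex is the neighbour on the cycle
  that is not its predecessor.
\<close>

lemma cyclic_edges_determine_list:
  assumes "distinct xs" "distinct ys" "length xs = n" "length ys = n" "3 \<le> n"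
    and ends: "hd xs = hd ys" "last xs = last ys"
    and edges: "arc_edge ` set (cyclic_arcs xs) = arc_edge ` set (cyclic_arcs ys)"
  shows "xs = ys"
proof -
  have inj: "xs ! i = xs ! j \<longleftrightarrow> i = j" "ys ! i = ys ! j \<longleftrightarrow> i = j" if "i < n" "j < n" for i j
    using assms that by (simp_all add: nth_eq_iff_index_eq)
  have "xs \<noteq> []" "ys \<noteq> []" using assms by auto
  then have first: "xs ! 0 = ys ! 0" and final: "xs ! (n - 1) = ys ! (n - 1)"
    using assms by (auto simp: hd_conv_nth last_conv_nth)
  have "xs ! i = ys ! i" if "i < n" for i
    using that
  proof (induction i rule: less_induct)
    case (less i)
    show ?case
    proof (cases i)
      case 0
      then show ?thesis using first by simp
    next
      case (Suc k)
      have IH: "xs ! k = ys ! k" using less Suc by simp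
      have "{xs ! k, xs ! i} \<in> arc_edge ` set (cyclic_arcs xs)"
        unfolding set_cyclic_arcs image_image arc_edge_def
        using less Suc assms by (intro image_eqI[of _ _ k]) auto
      then have "{xs ! k, xs ! i} \<in> arc_edge ` set (cyclic_arcs ys)" unfolding edges .
      then obtain j where j: "j < n" "{xs ! k, xs ! i} = {ys ! j, ys ! (Suc j mod n)}"
        unfolding set_cyclic_arcs image_image arc_edge_def using assms by auto
      have m: "Suc j mod n < n" using assms by simp
      from j(2) consider "xs ! k = ys ! j" "xs ! i = ys ! (Suc j mod n)"
        | "xs ! k = ys ! (Suc j mod n)" "xs ! i = ys ! j"
        by (auto simp: doubleton_eq_iff)
      then show ?thesis
      proof cases
        case 1
        then have "j = k" using IH inj j less Suc by simp
        then show ?thesis using 1 Suc less by simp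
      next
        case 2
        then have k: "k = Suc j mod n" using IH inj m less Suc by simp
        show ?thesis
        proof (cases "Suc j = n")
          case True
          then have "xs ! i = xs ! (n - 1)" "k = 0" using 2 k final by auto
          then have "i = n - 1" using inj less by auto
          then show ?thesis using \<open>k = 0\<close> Suc assms by simp
        next
          case False
          then have "k = Suc j" using k j by simp
          then have "xs ! j = ys ! j" using less Suc by simp
          then have "xs ! i = xs ! j" using 2 by simp
          then have "i = j" using inj less j by blast
          then show ?thesis using \<open>k = Suc j\<close> Suc by simp
        qed
      qed
    qed
  qed
  then show ?thesis using assms by (intro nth_equalityI) auto
qed

lemma add_edge_wf:
  assumes "pair_graph G" "u \<in> pverts G" "v \<in> pverts G"
  shows "pair_wf_digraph (add_edge G u v)"
proof -
  interpret pair_graph G by fact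
  show ?thesis
    using assms(2,3) by unfold_locales (auto simp: add_edge_def intro: in_arcsD1 in_arcsD2)
qed

text \<open>
  A cycle that arises from the new edge passes through it; removing the edge leaves a path between its
  ends, which is reversed if the cycle traverses the edge in the other direction.
\<close>

lemma path_of_new_cycle:
  assumes G: "pair_graph G" and uv: "u \<in> pverts G" "v \<in> pverts G"
    and new: "ucycle (add_edge G u v) C" "\<not> ucycle G C"
  shows "\<exists>xs. gpath (\<lambda>x y. (x, y) \<in> parcs G) xs \<and> length xs = card C \<and> hd xs = u \<and> last xs = v"
proof -
  interpret pair_graph G by fact
  let ?E = "\<lambda>x y. (x, y) \<in> parcs G"
  have wf: "pair_wf_digraph G" ..
  obtain xs where xs: "distinct xs" "3 \<le> length xs"
    "set (cyclic_arcs xs) \<subseteq> parcs (add_edge G u v)" "C = arc_edge ` set (cyclic_arcs xs)"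
    using new(1) unfolding ucycle_iff[OF add_edge_wf[OF G uv]] by blast
  have "\<not> set (cyclic_arcs xs) \<subseteq> parcs G"
    using new(2) xs unfolding ucycle_iff[OF wf] by blast
  then obtain i where i: "i < length xs" "(xs ! i, xs ! (Suc i mod length xs)) \<in> {(u, v), (v, u)}"
    using xs(3) unfolding set_cyclic_arcs add_edge_def by auto
  \<comment> \<open>The rotation makes the new edge the closing one, from the last vertex to the first.\<close>
  define ys where "ys = rotate (Suc i) xs"
  have ys: "distinct ys" "length ys = length xs" "ys \<noteq> []"
    using xs i by (auto simp: ys_def)
  have "hd ys = xs ! (Suc i mod length xs)"
    using ys(3) hd_rotate_conv_nth[of xs "Suc i"] by (simp add: ys_def del: rotate_Suc)
  moreover have "last ys = xs ! i"
  proof -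
    have "last ys = ys ! (length xs - 1)" using ys by (simp add: last_conv_nth)
    also have "\<dots> = xs ! ((Suc i + (length xs - 1)) mod length xs)"
      unfolding ys_def using i by (intro nth_rotate) simp
    also have "Suc i + (length xs - 1) = i + length xs" using i by simp
    finally show ?thesis using i by simp
  qed
  ultimately have ends: "(last ys, hd ys) \<in> {(u, v), (v, u)}" using i by simp
  have closed: "successively (\<lambda>x y. (x, y) \<in> parcs (add_edge G u v)) ys"
    using xs(3) set_cyclic_arcs_rotate[of "Suc i" xs] cyclic_arcs_subset_iff[OF ys(3)]
    unfolding ys_def by auto
  have "successively ?E ys"
    unfolding successively_conv_nth
  proof (intro allI impI)
    fix k assume k: "Suc k < length ys"
    have "ys ! k = ys ! 0 \<longleftrightarrow> k = 0" using k ys by (intro nth_eq_iff_index_eq) auto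
    then have "{ys ! k, ys ! Suc k} \<noteq> {hd ys, last ys}"
      using k ys xs(2)
      by (auto simp: hd_conv_nth last_conv_nth doubleton_eq_iff nth_eq_iff_index_eq)
    then have "(ys ! k, ys ! Suc k) \<notin> {(u, v), (v, u)}" using ends by auto
    then show "(ys ! k, ys ! Suc k) \<in> parcs G"
      using closed k unfolding successively_conv_nth add_edge_def by auto
  qed
  then have path: "gpath ?E ys" using ys by (simp add: gpath_def)
  moreover have "gpath ?E (rev ys)"
    using path arcs_symmetric by (auto simp: gpath_def successively_rev elim: successively_mono)
  moreover have "length ys = card C" using xs ys card_cyclic_edges by metis
  ultimately show ?thesis
    using ends ys by (auto simp: hd_rev last_rev intro: exI[of _ ys] exI[of _ "rev ys"])
qed

text \<open>
  Otherwise the removal of \<open>y\<close> would isolate \<open>x\<close>.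
\<close>

lemma two_connected_other_neighbour:
  assumes G: "pair_graph G" and conn: "k_connected 2 G" and xy: "(x, y) \<in> parcs G"
  shows "\<exists>z. z \<noteq> y \<and> (x, z) \<in> parcs G"
proof -
  interpret pair_graph G by fact
  have x: "x \<in> pverts G" and y: "y \<in> pverts G" using xy in_arcsD1 in_arcsD2 by blast+
  have "x \<noteq> y" using pair_no_loops[OF xy] by simp
  let ?H = "with_proj G \<restriction> (pverts G - {y})"
  have "card {x, y} < card (pverts G)" using conn \<open>x \<noteq> y\<close> by (simp add: k_connected_def)
  then have "\<not> pverts G \<subseteq> {x, y}" using card_mono[of "{x, y}" "pverts G"] by auto
  then obtain w where w: "w \<in> pverts G" "w \<noteq> x" "w \<noteq> y" by auto
  have "connected ?H" using conn y by (simp add: k_connected_def)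
  then have "x \<rightarrow>\<^sup>*\<^bsub>mk_symmetric ?H\<^esub> w"
    unfolding connected_def strongly_connected_def using x w \<open>x \<noteq> y\<close> by auto
  then obtain z where "(x, z) \<in> parcs (mk_symmetric ?H)"
    using w unfolding reachable_def by (auto elim: converse_rtrancl_on_cases)
  then show ?thesis using arcs_symmetric by (auto simp: parcs_mk_symmetric)
qed

section \<open>Uniquely saturated graphs\<close>

text \<open>
  Nine-paths with the same ends are closed by the edge between these to 9-cycles of the augmented
  graph. Saturation makes the edge sets of two such cycles equal, and an edge set determines the path.
\<close>

lemma unique_nine_path_graph_if_uniquely_saturated:
  assumes G: "pair_graph G" and conn: "k_connected 2 G" and sat: "uniquely_cycle_saturated 9 G"
  shows "unique_nine_path_graph (pverts G) (\<lambda>x y. (x, y) \<in> parcs G)"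
proof -
  interpret pair_graph G by fact
  let ?E = "\<lambda>x y. (x, y) \<in> parcs G"
  have wf: "pair_wf_digraph G" ..
  have no_C9: "\<not> (ucycle G C \<and> card C = 9)" for C
    using sat unfolding uniquely_cycle_saturated_def by blast
  have symm: "?E y x" if "?E x y" for x y using that arcs_symmetric by blast
  have no_nine_cycle: "\<not> ?E (hd xs) (last xs)" if "gpath ?E xs" "length xs = 9" for xs
  proof
    assume "?E (hd xs) (last xs)"
    then have "?E (last xs) (hd xs)" by (rule symm)
    then show False using cycle_of_path[OF wf that(1)] that(2) no_C9 by simp
  qed
  show ?thesis
  proof
    fix x y assume "?E x y"
    then show "?E y x" by (rule symm)
  next
    fix x show "\<not> ?E x x" using pair_no_loops by fastforce
  next
    fix x y assume "?E x y"
    then show "x \<in> pverts G" by (rule in_arcsD1)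
  next
    fix x y assume "?E x y"
    then show "\<exists>z. z \<noteq> y \<and> ?E x z" by (rule two_connected_other_neighbour[OF G conn])
  next
    fix xs assume "gpath ?E xs" "length xs = 9"
    then show "\<not> ?E (hd xs) (last xs)" by (rule no_nine_cycle)
  next
    fix x y assume xy: "x \<in> pverts G" "y \<in> pverts G" "x \<noteq> y" "\<not> ?E x y"
    then obtain C where C: "ucycle (add_edge G x y) C" "card C = 9"
      using sat unfolding uniquely_cycle_saturated_def by blast
    then show "\<exists>xs. gpath ?E xs \<and> length xs = 9 \<and> hd xs = x \<and> last xs = y"
      using path_of_new_cycle[OF G xy(1,2) C(1)] no_C9 by auto
  next
    fix xs ys assume xs: "gpath ?E xs" "length xs = 9" and ys: "gpath ?E ys" "length ys = 9"
      and ends: "hd xs = hd ys" "last xs = last ys"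
    let ?G = "add_edge G (hd xs) (last xs)"
    have "xs \<noteq> []" using xs by auto
    then have nth: "hd xs = xs ! 0" "last xs = xs ! 8"
      using xs by (simp_all add: hd_conv_nth last_conv_nth)
    have "?E (xs ! i) (xs ! Suc i)" if "i < 8" for i
      using xs that unfolding gpath_def successively_conv_nth by simp
    from this[of 0] this[of 7] have "?E (xs ! 0) (xs ! 1)" "?E (xs ! 7) (xs ! 8)" by simp_all
    then have in_V: "hd xs \<in> pverts G" "last xs \<in> pverts G"
      unfolding nth using in_arcsD1 in_arcsD2 by simp_all
    have neq: "hd xs \<noteq> last xs"
      unfolding nth using xs by (simp add: gpath_def nth_eq_iff_index_eq)
    have wf': "pair_wf_digraph ?G" using add_edge_wf[OF G in_V] .
    have closed: "ucycle ?G (arc_edge ` set (cyclic_arcs zs)) \<and> card (arc_edge ` set (cyclic_arcs zs)) = 9"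
      if zs: "gpath ?E zs" "length zs = 9" "hd zs = hd xs" "last zs = last xs" for zs
    proof -
      have "gpath (\<lambda>x y. (x, y) \<in> parcs ?G) zs"
        using zs(1) by (auto simp: gpath_def add_edge_def elim: successively_mono)
      then show ?thesis using cycle_of_path[OF wf', of zs] zs by (simp add: add_edge_def)
    qed
    have "\<exists>!C. ucycle ?G C \<and> card C = 9"
      using sat in_V neq no_nine_cycle[OF xs]
      unfolding uniquely_cycle_saturated_def by blast
    then have "arc_edge ` set (cyclic_arcs xs) = arc_edge ` set (cyclic_arcs ys)"
      using closed[OF xs refl refl] closed[OF ys ends[symmetric]] by blast
    then show "xs = ys"
      using xs ys ends by (intro cyclic_edges_determine_list[of xs ys 9]) (auto simp: gpath_def)
  qed
qed

lemma twelve_cycle_of_ucycle: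
  assumes G: "unique_nine_path_graph (pverts G) (\<lambda>x y. (x, y) \<in> parcs G)"
    and wf: "pair_wf_digraph G" and C: "ucycle G C" "card C = 12"
  shows "\<exists>c. unique_nine_path_graph.twelve_cycle (\<lambda>x y. (x, y) \<in> parcs G) c"
proof -
  interpret unique_nine_path_graph "pverts G" "\<lambda>x y. (x, y) \<in> parcs G" by fact
  obtain xs where xs: "distinct xs" "3 \<le> length xs" "set (cyclic_arcs xs) \<subseteq> parcs G"
     "C = arc_edge ` set (cyclic_arcs xs)"
    using C unfolding ucycle_iff[OF wf] by blast
  have len: "length xs = 12" using C xs card_cyclic_edges[of xs] by simp
  have "twelve_cycle (\<lambda>i. xs ! (i mod 12))"
    unfolding twelve_cycle_def
  proof (intro conjI allI)
    fix i :: nat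
    have "(xs ! m, xs ! (Suc m mod 12)) \<in> parcs G" if "m < 12" for m
      using xs(3) len that unfolding set_cyclic_arcs by auto
    from this[of "i mod 12"] show "(xs ! (i mod 12), xs ! ((i + 1) mod 12)) \<in> parcs G" by (simp add: mod_simps)
  next
    fix i j :: nat
    show "xs ! (i mod 12) = xs ! (j mod 12) \<longleftrightarrow> i mod 12 = j mod 12"
      using xs(1) len by (simp add: nth_eq_iff_index_eq)
  qed
  then show ?thesis by blast
qed

theorem proposition3p10:
  fixes G :: "'a pair_pre_digraph"
  assumes "pair_graph G"
    and "k_connected 2 G"
    and "9 \<le> card (pverts G)"
    and "uniquely_cycle_saturated 9 G"
  shows "\<not> (\<exists>C. longest_even_cycle_upto 12 G C \<and> card C = 12) \<and>
         \<not> (\<exists>C. ucycle G C \<and> card C = 12)"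
proof -
  have G: "unique_nine_path_graph (pverts G) (\<lambda>x y. (x, y) \<in> parcs G)"
    using assms by (intro unique_nine_path_graph_if_uniquely_saturated)
  interpret pair_graph G by fact
  have wf: "pair_wf_digraph G" ..
  have "\<not> (\<exists>C. ucycle G C \<and> card C = 12)"
    using twelve_cycle_of_ucycle[OF G wf] unique_nine_path_graph.no_twelve_cycle[OF G] by blast
  moreover have "ucycle G C" if "longest_even_cycle_upto 12 G C" for C
    using that by (simp add: longest_even_cycle_upto_def is_arg_max_def)
  ultimately show ?thesis by blast
qed

end
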